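(* Let $2\le h<g$ be fixed integers such that $h\mid g$ and such that $h$ and $g$ are multiplicatively independent. Then for every $\epsilon>0$ there exist constants $c>0$ and $x_0>0$, depending only on $\epsilon,g,h$ and explicitly (effectively) computable from them, such that for all $x\ge x_0$ there are at least $c\,x^{1/2-\epsilon}$ positive integers $N\le x$ that are palindromes in base $g$ but are not palindromes in base $h$.
   Context: For an integer $b\ge 2$ and a positive integer $a$ with base-$b$ expansion $a=\sum_{i=0}^k a_i b^i$, $a_i\in\{0,1,\dots,b-1\}$, $a_k\neq 0$, the digit reversal of $a$ in base $b$ is $\overline{(a)_b}=\sum_{i=0}^k a_i b^{k-i}$. The integer $a$ is called a palindrome in base $b$ if $a=\overline{(a)_b}$. Integers $g,h\geq 2$ are multiplicatively independent if $g^x h^y=1$ with $x,y\in\mathbb{Z}$ implies $x=y=0$. *)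

theory Defs
  imports Complex_Main
begin

subsection \<open>Palindromes\<close>

definition digit :: "nat \<Rightarrow> nat \<Rightarrow> nat \<Rightarrow> nat" where
  "digit b a i = (a div b ^ i) mod b"

definition top_index :: "nat \<Rightarrow> nat \<Rightarrow> nat" where
  "top_index b a = (GREATEST k. digit b a k \<noteq> 0)"

definition digit_reversal :: "nat \<Rightarrow> nat \<Rightarrow> nat" where
  "digit_reversal b a = (\<Sum>i\<le>top_index b a. digit b a i * b ^ (top_index b a - i))"

definition palindrome :: "nat \<Rightarrow> nat \<Rightarrow> bool" where
  "palindrome b a \<longleftrightarrow> a = digit_reversal b a"

lemma sum_digits_less:
  fixes d :: "nat \<Rightarrow> nat"
  assumes "b \<ge> 2" "\<And>i. i < n \<Longrightarrow> d i < b"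
  shows "(\<Sum>i<n. d i * b ^ i) < b ^ n"
  using assms(2)
proof (induction n)
  case (Suc n)
  have "d n * b ^ n + b ^ n \<le> b * b ^ n"
    using mult_le_mono1[of "Suc (d n)" b "b ^ n"] Suc.prems[of n] by simp
  moreover have "(\<Sum>i<n. d i * b ^ i) < b ^ n"
    using Suc by simp
  ultimately show ?case by simp
qed simp

lemma digit_sum:
  assumes "b \<ge> 2" "\<And>i. i \<le> k \<Longrightarrow> d i < b"
  shows "digit b (\<Sum>i\<le>k. d i * b ^ i) j = (if j \<le> k then d j else 0)"
proof (cases "j \<le> k")
  case True
  let ?r = "\<Sum>i<j. d i * b ^ i"
  have split: "{..k} = {..<j} \<union> {j} \<union> {Suc j..k}"
    using True by auto
  have r: "?r < b ^ j"
    using True assms by (intro sum_digits_less) auto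
  have "b ^ Suc j dvd (\<Sum>i=Suc j..k. d i * b ^ i)"
    by (intro dvd_sum dvd_mult le_imp_power_dvd) auto
  then obtain q where q: "(\<Sum>i=Suc j..k. d i * b ^ i) = b ^ Suc j * q" ..
  have "(\<Sum>i\<le>k. d i * b ^ i) = ?r + d j * b ^ j + (\<Sum>i=Suc j..k. d i * b ^ i)"
    unfolding split by (subst sum.union_disjoint; auto)+
  also have "\<dots> = ?r + b ^ j * (d j + b * q)"
    unfolding q by (simp add: algebra_simps)
  finally have "(\<Sum>i\<le>k. d i * b ^ i) div b ^ j = d j + b * q"
    using r assms(1) by simp
  then show ?thesis
    using True assms by (simp add: digit_def)
next
  case False
  have "(\<Sum>i\<le>k. d i * b ^ i) < b ^ Suc k"
    using sum_digits_less[of b "Suc k" d] assms by (simp add: lessThan_Suc_atMost)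
  also have "\<dots> \<le> b ^ j"
    using False assms(1) by (intro power_increasing) auto
  finally show ?thesis
    using False by (simp add: digit_def)
qed

lemma digit_reversal_expansion:
  assumes "b \<ge> 2" "\<And>i. i \<le> k \<Longrightarrow> d i < b" "d k \<noteq> 0"
  shows "digit_reversal b (\<Sum>i\<le>k. d i * b ^ i) = (\<Sum>i\<le>k. d i * b ^ (k - i))"
proof -
  have digit: "digit b (\<Sum>i\<le>k. d i * b ^ i) j = (if j \<le> k then d j else 0)" for j
    using assms by (intro digit_sum)
  have "top_index b (\<Sum>i\<le>k. d i * b ^ i) = k"
    unfolding top_index_def digit
    by (rule Greatest_equality) (use assms(3) in \<open>auto split: if_splits\<close>)
  then show ?thesis
    by (simp add: digit_reversal_def digit)
qed

subsection \<open>Multiplicative independence\<close>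

definition multiplicatively_independent :: "nat \<Rightarrow> nat \<Rightarrow> bool" where
  "multiplicatively_independent g h \<longleftrightarrow>
     (\<forall>x y :: int. real g powi x * real h powi y = 1 \<longrightarrow> x = 0 \<and> y = 0)"

subsection \<open>Effective computability\<close>

text \<open>
  Partial recursive functions on tuples of natural numbers, relative to an oracle
  \<open>\<phi>\<close> through which a real argument is supplied.
  \<open>computes \<phi> p xs y\<close> means that \<open>p\<close> halts on \<open>xs\<close> with output \<open>y\<close>.
\<close>

datatype prog =
    Zero
  | Succ
  | Proj nat
  | Oracle
  | Comp prog "prog list"
  | Prim_Rec prog prog
  | Mu prog

inductive computes :: "(nat \<Rightarrow> nat) \<Rightarrow> prog \<Rightarrow> nat list \<Rightarrow> nat \<Rightarrow> bool"
  for \<phi> :: "nat \<Rightarrow> nat"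
where
  Zero: "computes \<phi> Zero xs 0"
| Succ: "computes \<phi> Succ [x] (Suc x)"
| Proj: "i < length xs \<Longrightarrow> computes \<phi> (Proj i) xs (xs ! i)"
| Oracle: "computes \<phi> Oracle [x] (\<phi> x)"
| Comp: "\<lbrakk>list_all2 (\<lambda>q y. computes \<phi> q xs y) qs ys; computes \<phi> p ys z\<rbrakk>
    \<Longrightarrow> computes \<phi> (Comp p qs) xs z"
| Prim_Rec_0: "computes \<phi> p xs y \<Longrightarrow> computes \<phi> (Prim_Rec p q) (0 # xs) y"
| Prim_Rec_Suc: "\<lbrakk>computes \<phi> (Prim_Rec p q) (n # xs) y; computes \<phi> q (n # y # xs) z\<rbrakk>
    \<Longrightarrow> computes \<phi> (Prim_Rec p q) (Suc n # xs) z"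
| Mu: "\<lbrakk>computes \<phi> p (n # xs) 0; \<forall>m<n. \<exists>y>0. computes \<phi> p (m # xs) y\<rbrakk>
    \<Longrightarrow> computes \<phi> (Mu p) xs n"

inductive_cases computes_ZeroE: "computes \<phi> Zero xs y"
inductive_cases computes_SuccE: "computes \<phi> Succ xs y"
inductive_cases computes_ProjE: "computes \<phi> (Proj i) xs y"
inductive_cases computes_OracleE: "computes \<phi> Oracle xs y"
inductive_cases computes_CompE: "computes \<phi> (Comp p qs) xs y"
inductive_cases computes_Prim_Rec_0E: "computes \<phi> (Prim_Rec p q) (0 # xs) y"
inductive_cases computes_Prim_Rec_SucE: "computes \<phi> (Prim_Rec p q) (Suc n # xs) y"
inductive_cases computes_MuE: "computes \<phi> (Mu p) xs y"

lemma computes_deterministic: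
  assumes "computes \<phi> p xs y" "computes \<phi> p xs z"
  shows "y = z"
  using assms
proof (induction arbitrary: z rule: computes.induct)
  case (Comp xs qs ys p y)
  from Comp.prems obtain ys' where ys': "list_all2 (\<lambda>q y. computes \<phi> q xs y) qs ys'"
    and z: "computes \<phi> p ys' z" by (elim computes_CompE) auto
  have "ys = ys'"
    using Comp.IH(1) ys' by (auto simp: list_all2_conv_all_nth intro!: nth_equalityI)
  with z Comp.IH(2) show ?case by simp
next
  case (Prim_Rec_Suc p q n xs y w)
  from Prim_Rec_Suc.prems show ?case
    by (rule computes_Prim_Rec_SucE) (use Prim_Rec_Suc.IH in blast)
next
  case (Mu p n xs)
  from Mu.prems have z: "computes \<phi> p (z # xs) 0" "\<forall>m<z. \<exists>y>0. computes \<phi> p (m # xs) y"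
    by (auto elim: computes_MuE)
  have "\<not> z < n" using Mu.IH(2) z(1) by fastforce
  moreover have "\<not> n < z" using Mu.IH(1) z(2) by fastforce
  ultimately show ?case by simp
qed (blast elim: computes_ZeroE computes_SuccE computes_ProjE computes_OracleE
       computes_Prim_Rec_0E)+

text \<open>A name of a nonnegative real: its dyadic approximations, the \<open>n\<close>-th with error at most \<open>2\<^sup>-\<^sup>n\<close>.\<close>

definition is_name :: "(nat \<Rightarrow> nat) \<Rightarrow> real \<Rightarrow> bool" where
  "is_name \<phi> r \<longleftrightarrow> (\<forall>n. \<bar>r - real (\<phi> n) / 2 ^ n\<bar> \<le> 1 / 2 ^ n)"

text \<open>
  Computability in the sense of computable analysis: one program, uniform in all
  parameters \<open>(\<epsilon>, g, h) \<in> D\<close>, turns every name of \<open>\<epsilon>\<close> and the integers \<open>g, h\<close> into a name of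
  \<open>c \<epsilon> g h\<close>. Uniformity is essential, since for fixed parameters every rational constant is
  computable.
\<close>

definition effectively_computable_on ::
  "(real \<times> nat \<times> nat) set \<Rightarrow> (real \<Rightarrow> nat \<Rightarrow> nat \<Rightarrow> real) \<Rightarrow> bool" where
  "effectively_computable_on D c \<longleftrightarrow>
     (\<exists>p. \<forall>(\<epsilon>, g, h) \<in> D. \<forall>\<phi>. is_name \<phi> \<epsilon> \<longrightarrow>
        (\<exists>\<psi>. (\<forall>n. computes \<phi> p [g, h, n] (\<psi> n)) \<and> is_name \<psi> (c \<epsilon> g h)))"

end

theory Submission
  imports Defs
begin

text \<open>
  A positive multiple of \<open>h\<close> ends in the digit \<open>0\<close> in base \<open>h\<close>, so it is not a palindrome there.
  Since \<open>h < g\<close> and \<open>h\<close> divides \<open>g\<close>, every base-\<open>g\<close> palindrome whose first and last digit is \<open>h\<close>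
  is such a multiple. There are \<open>g ^ m\<close> of these with \<open>2 * m + 1\<close> digits, which gives the
  bound even for \<open>\<epsilon> = 0\<close>, with \<open>c = 1 / 4 ^ g\<close> and \<open>x\<^sub>0 = 2 ^ g\<close>;
  powers of two make the dyadic approximations trivial to compute.
\<close>

subsection \<open>Digits and palindromes\<close>

lemma sum_digit_eq_mod: "(\<Sum>i<n. digit b a i * b ^ i) = a mod b ^ n"
proof (induction n)
  case (Suc n)
  have "a mod b ^ Suc n = b ^ n * (a div b ^ n mod b) + a mod b ^ n"
    using mod_mult2_eq[of a "b ^ n" b] by (simp add: mult.commute)
  with Suc show ?case
    by (simp add: digit_def)
qed simp

text \<open>\<open>GREATEST\<close> needs a nonempty, bounded set of positions. Since
  \<open>k < b ^ k\<close>, all-zero digits would force \<open>a = a mod b ^ a = 0\<close>, and no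
  nonzero digit lies above position \<open>a\<close>.\<close>

lemma digit_top_index_nonzero:
  assumes "b \<ge> 2" "a > 0"
  shows "digit b a (top_index b a) \<noteq> 0"
proof -
  have less: "k < b ^ k" for k
    using assms(1) by (intro power_gt_expt) simp
  have "\<exists>k. digit b a k \<noteq> 0"
  proof (rule ccontr)
    assume "\<nexists>k. digit b a k \<noteq> 0"
    then have "a mod b ^ a = 0"
      using sum_digit_eq_mod[of b a a] by simp
    then show False
      using less[of a] assms(2) by simp
  qed
  moreover have "k \<le> a" if "digit b a k \<noteq> 0" for k
  proof (rule ccontr)
    assume "\<not> k \<le> a"
    then have "a < b ^ k"
      using less[of k] by simp
    then show False
      using that by (simp add: digit_def)
  qed
  ultimately show ?thesis
    unfolding top_index_def by (metis (mono_tags, lifting) GreatestI_ex_nat)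
qed

text \<open>Reversal moves the final zero to the top, so the reversal drops below
  \<open>b ^ k\<close>, whereas the nonzero top digit keeps \<open>a\<close> at or above
  \<open>b ^ k\<close>.\<close>

lemma dvd_imp_not_palindrome:
  assumes "b \<ge> 2" "a > 0" "b dvd a"
  shows "\<not> palindrome b a"
proof -
  define k where "k = top_index b a"
  have "digit_reversal b a = (\<Sum>j\<le>k. digit b a (k - j) * b ^ j)"
    unfolding digit_reversal_def k_def[symmetric]
    using sum.nat_diff_reindex[of "\<lambda>j. digit b a (k - j) * b ^ j" "Suc k"]
    by (simp add: lessThan_Suc_atMost)
  \<comment> \<open>The term \<open>j = k\<close> carries the last digit of \<open>a\<close>, which
    is 0.\<close>
  also have "\<dots> = (\<Sum>j<k. digit b a (k - j) * b ^ j)"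
    using assms(3) by (simp add: lessThan_Suc_atMost[symmetric] digit_def)
  also have "\<dots> < b ^ k"
    using assms(1) by (intro sum_digits_less) (auto simp: digit_def)
  also have "b ^ k \<le> a"
    using digit_top_index_nonzero[OF assms(1,2)]
    by (cases "a < b ^ k") (auto simp: k_def digit_def)
  finally show ?thesis
    by (simp add: palindrome_def)
qed

text \<open>
  The base-\<open>g\<close> digits, from the lowest: \<open>h\<close>, the \<open>m\<close> lowest digits of \<open>t\<close>, then all this
  reflected about its last digit (for \<open>m = 0\<close> just \<open>h\<close>).
\<close>

definition framed_digit :: "nat \<Rightarrow> nat \<Rightarrow> nat \<Rightarrow> nat \<Rightarrow> nat \<Rightarrow> nat" where
  "framed_digit g h m t i =
     (if i = 0 \<or> i = 2 * m then h else digit g t (min i (2 * m - i) - 1))"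

definition framed_palindrome :: "nat \<Rightarrow> nat \<Rightarrow> nat \<Rightarrow> nat \<Rightarrow> nat" where
  "framed_palindrome g h m t = (\<Sum>i\<le>2 * m. framed_digit g h m t i * g ^ i)"

section \<open>Palindromes framed by the digit \<open>h\<close>\<close>

context
  fixes g h :: nat
  assumes h: "2 \<le> h" and hg: "h < g"
begin

lemma framed_digit_less: "framed_digit g h m t i < g"
  using h hg by (simp add: framed_digit_def digit_def)

lemma digit_framed_palindrome:
  "i \<le> 2 * m \<Longrightarrow> digit g (framed_palindrome g h m t) i = framed_digit g h m t i"
  unfolding framed_palindrome_def
  using h hg framed_digit_less by (subst digit_sum) auto

lemma palindrome_framed_palindrome: "palindrome g (framed_palindrome g h m t)"
proof -
  let ?d = "framed_digit g h m t"
  have "digit_reversal g (framed_palindrome g h m t) = (\<Sum>i\<le>2 * m. ?d i * g ^ (2 * m - i))"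
    unfolding framed_palindrome_def
    using h hg framed_digit_less
    by (intro digit_reversal_expansion) (auto simp: framed_digit_def)
  \<comment> \<open>The digits are invariant under the reflection of \<open>i\<close> to
    \<open>2 * m - i\<close>.\<close>
  also have "\<dots> = (\<Sum>i\<le>2 * m. ?d (2 * m - i) * g ^ (2 * m - i))"
    by (intro sum.cong refl) (auto simp: framed_digit_def min.commute)
  also have "\<dots> = framed_palindrome g h m t"
    unfolding framed_palindrome_def
    using sum.nat_diff_reindex[of "\<lambda>i. ?d i * g ^ i" "Suc (2 * m)"]
    by (simp add: lessThan_Suc_atMost)
  finally show ?thesis
    by (simp add: palindrome_def)
qed

lemma framed_palindrome_less: "framed_palindrome g h m t < g ^ (2 * m + 1)"
  unfolding framed_palindrome_def
  using sum_digits_less[of g "Suc (2 * m)" "framed_digit g h m t"] framed_digit_less h hg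
  by (simp add: lessThan_Suc_atMost)

lemma framed_palindrome_pos: "framed_palindrome g h m t > 0"
proof (rule ccontr)
  assume "\<not> framed_palindrome g h m t > 0"
  then show False
    using digit_framed_palindrome[of 0 m t] h by (simp add: digit_def framed_digit_def)
qed

lemma dvd_framed_palindrome:
  assumes "h dvd g"
  shows "h dvd framed_palindrome g h m t"
proof -
  have "framed_palindrome g h m t mod g = h"
    using digit_framed_palindrome[of 0 m t] by (simp add: digit_def framed_digit_def)
  then show ?thesis
    using assms by (metis dvd_mod_iff dvd_refl)
qed

text \<open>Positions 1 to \<open>m\<close> carry the \<open>m\<close> low digits of
  \<open>t\<close>, and these determine \<open>t\<close> below \<open>g ^ m\<close>.\<close>

lemma inj_on_framed_palindrome: "inj_on (framed_palindrome g h m) {..<g ^ m}"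
proof (rule inj_onI)
  fix s t
  assume s: "s \<in> {..<g ^ m}" and t: "t \<in> {..<g ^ m}"
    and eq: "framed_palindrome g h m s = framed_palindrome g h m t"
  have "digit g s i = digit g t i" if "i < m" for i
    using digit_framed_palindrome[of "Suc i" m s] digit_framed_palindrome[of "Suc i" m t] that
    by (simp add: eq framed_digit_def min_def split: if_splits)
  then have "s mod g ^ m = t mod g ^ m"
    by (simp flip: sum_digit_eq_mod)
  then show "s = t"
    using s t by simp
qed

section \<open>Counting up to a real bound\<close>

lemma card_palindromes_not_palindromes_ge:
  assumes "h dvd g" "real (g ^ (2 * m + 1)) \<le> x"
  shows "g ^ m \<le> card {N. 0 < N \<and> real N \<le> x \<and> palindrome g N \<and> \<not> palindrome h N}"
    (is "_ \<le> card ?S")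
proof -
  \<comment> \<open>An infinite set would have \<open>card\<close> equal to 0.\<close>
  have "finite ?S"
    by (rule finite_subset[of _ "{..nat \<lfloor>x\<rfloor>}"]) (auto simp: le_nat_floor)
  moreover have "framed_palindrome g h m ` {..<g ^ m} \<subseteq> ?S"
  proof (rule image_subsetI)
    fix t
    have "real (framed_palindrome g h m t) \<le> x"
      using framed_palindrome_less[of m t] assms(2) by linarith
    then show "framed_palindrome g h m t \<in> ?S"
      using palindrome_framed_palindrome framed_palindrome_pos
        dvd_imp_not_palindrome[OF h framed_palindrome_pos dvd_framed_palindrome[OF assms(1)]]
      by simp
  qed
  ultimately show ?thesis
    using card_mono card_image[OF inj_on_framed_palindrome] by (metis card_lessThan)
qed

text \<open>Take \<open>m\<close> with \<open>g ^ (2 * m + 1) \<le> x < g ^ (2 * m + 3)\<close>: the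
  \<open>g ^ m\<close> palindromes of length \<open>2 * m + 1\<close> all fit, and
  \<open>g ^ m\<close> falls short of \<open>sqrt x\<close> by at most the factor
  \<open>g ^ 2\<close>.\<close>

lemma card_palindromes_not_palindromes_ge_sqrt:
  assumes "h dvd g" "real g \<le> x"
  shows "sqrt x / real g ^ 2
    \<le> real (card {N. 0 < N \<and> real N \<le> x \<and> palindrome g N \<and> \<not> palindrome h N})"
    (is "_ \<le> real ?c")
proof -
  have g: "real g > 1"
    using h hg by simp
  obtain n where n: "x < real g ^ n"
    using real_arch_pow[OF g] by blast
  let ?P = "\<lambda>m. x < real g ^ (2 * m + 3)"
  have "real g ^ n \<le> real g ^ (2 * n + 3)"
    using g by (intro power_increasing) auto
  then have "?P n"
    using n by simp
  define m where "m = (LEAST m. ?P m)"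
  have upper: "?P m"
    unfolding m_def using \<open>?P n\<close> by (rule LeastI)
  \<comment> \<open>For \<open>m = Suc l\<close>, minimality refutes \<open>?P l\<close>, whose
    exponent is \<open>2 * l + 3 = 2 * m + 1\<close>; for \<open>m = 0\<close> this is the
    assumption on \<open>x\<close>.\<close>
  have lower: "real g ^ (2 * m + 1) \<le> x"
  proof (cases m)
    case (Suc l)
    then have "\<not> ?P l"
      unfolding m_def by (intro not_less_Least) simp
    with Suc show ?thesis
      by (simp add: eval_nat_numeral)
  qed (use assms in simp)
  \<comment> \<open>The exponent is rounded up to an even one, so that the power is a
    square.\<close>
  have "x \<le> real g ^ (2 * m + 4)"
    using upper g power_increasing[of "2 * m + 3" "2 * m + 4" "real g"] by linarith
  also have "\<dots> = (real g ^ (m + 2)) ^ 2"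
    by (simp add: power_add power_even_eq power_mult_distrib eval_nat_numeral)
  finally have "sqrt x \<le> real g ^ (m + 2)"
    by (intro real_le_lsqrt) auto
  then have "sqrt x / real g ^ 2 \<le> real g ^ m"
    using g by (simp add: divide_le_eq power2_eq_square mult_ac)
  also have "\<dots> \<le> real ?c"
    using card_palindromes_not_palindromes_ge[of m x] assms(1) lower
    by (metis of_nat_le_iff of_nat_power)
  finally show ?thesis .
qed

end

subsection \<open>Programs for the constants\<close>

text \<open>The step program of \<open>Prim_Rec\<close> receives the counter, then the previous
  value, then the parameters; so \<open>Proj 1\<close> is the recursive value.\<close>

definition add_prog :: prog where
  "add_prog = Prim_Rec (Proj 0) (Comp Succ [Proj 1])"

definition pred_prog :: prog where
  "pred_prog = Prim_Rec Zero (Proj 0)"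

text \<open>Recursion runs on the first argument, so the subtrahend comes first.\<close>

definition monus_prog :: prog where
  "monus_prog = Prim_Rec (Proj 0) (Comp pred_prog [Proj 1])"

definition pow2_prog :: prog where
  "pow2_prog = Prim_Rec (Comp Succ [Zero]) (Comp add_prog [Proj 1, Proj 1])"

lemma computes_Proj: "i < length xs \<Longrightarrow> y = xs ! i \<Longrightarrow> computes \<phi> (Proj i) xs y"
  by (simp add: computes.Proj)

lemma computes_Comp1:
  "computes \<phi> q xs y \<Longrightarrow> computes \<phi> p [y] z \<Longrightarrow> computes \<phi> (Comp p [q]) xs z"
  by (rule computes.Comp[where ys = "[y]"]) auto

lemma computes_Comp2:
  "computes \<phi> q xs y \<Longrightarrow> computes \<phi> r xs y' \<Longrightarrow> computes \<phi> p [y, y'] z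
    \<Longrightarrow> computes \<phi> (Comp p [q, r]) xs z"
  by (rule computes.Comp[where ys = "[y, y']"]) auto

lemma computes_add_prog: "computes \<phi> add_prog [m, n] (m + n)"
  unfolding add_prog_def
proof (induction m)
  case 0
  show ?case
    by (intro computes.Prim_Rec_0 computes_Proj) auto
next
  case (Suc m)
  have "computes \<phi> (Comp Succ [Proj 1]) [m, m + n, n] (Suc (m + n))"
    by (rule computes_Comp1[OF computes_Proj[OF _ refl]]) (auto intro: computes.Succ)
  with Suc show ?case
    by (auto intro: computes.Prim_Rec_Suc)
qed

lemma computes_pred_prog: "computes \<phi> pred_prog [m] (m - 1)"
  unfolding pred_prog_def
proof (induction m)
  case 0
  show ?case
    by (auto intro: computes.intros)
next
  case (Suc m)
  then show ?case
    by (rule computes.Prim_Rec_Suc) (auto intro: computes_Proj)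
qed

lemma computes_monus_prog: "computes \<phi> monus_prog [m, n] (n - m)"
  unfolding monus_prog_def
proof (induction m)
  case 0
  show ?case
    by (intro computes.Prim_Rec_0 computes_Proj) auto
next
  case (Suc m)
  have "computes \<phi> (Comp pred_prog [Proj 1]) [m, n - m, n] (n - m - 1)"
    by (rule computes_Comp1[OF computes_Proj[OF _ refl]])
      (use computes_pred_prog[of \<phi> "n - m"] in auto)
  with Suc show ?case
    by (auto intro: computes.Prim_Rec_Suc)
qed

lemma computes_pow2_prog: "computes \<phi> pow2_prog [m] (2 ^ m)"
  unfolding pow2_prog_def
proof (induction m)
  case 0
  have "computes \<phi> (Comp Succ [Zero]) [] (Suc 0)"
    by (rule computes_Comp1[OF computes.Zero computes.Succ])
  then show ?case
    by (auto intro: computes.Prim_Rec_0)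
next
  case (Suc m)
  have "computes \<phi> (Comp add_prog [Proj 1, Proj 1]) [m, 2 ^ m] (2 ^ m + 2 ^ m)"
    by (rule computes_Comp2[OF computes_Proj computes_Proj computes_add_prog]) auto
  with Suc show ?case
    by (auto intro: computes.Prim_Rec_Suc simp: mult_2)
qed

section \<open>Names of the constants\<close>

lemma is_name_power2: "is_name (\<lambda>n. 2 ^ (k + n)) (2 ^ k)"
  by (simp add: is_name_def power_add)

lemma is_name_inverse_power2: "is_name (\<lambda>n. 2 ^ (n - k)) (1 / 2 ^ k)"
  unfolding is_name_def
proof
  fix n
  show "\<bar>1 / 2 ^ k - real (2 ^ (n - k)) / 2 ^ n\<bar> \<le> 1 / 2 ^ n"
  proof (cases "k \<le> n")
    case True
    then have "(2 :: real) ^ n = 2 ^ (n - k) * 2 ^ k"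
      by (simp flip: power_add)
    then show ?thesis
      by simp
  next
    \<comment> \<open>Here \<open>n - k\<close> truncates to 0, so the approximation is
      \<open>1 / 2 ^ n\<close>; the true value lies between 0 and it.\<close>
    case False
    then have "1 / 2 ^ k \<le> 1 / (2 :: real) ^ n"
      by (intro divide_left_mono power_increasing) auto
    moreover have "1 / (2 :: real) ^ k \<ge> 0"
      by simp
    ultimately show ?thesis
      using False by simp
  qed
qed

text \<open>For constants determined by the integers, one sequence \<open>\<psi> g h\<close> serves
  every name of \<epsilon>.\<close>

lemma effectively_computable_on_integer_parameters:
  assumes "\<And>\<phi> g h n. computes \<phi> p [g, h, n] (\<psi> g h n)" "\<And>g h. is_name (\<psi> g h) (c g h)"
  shows "effectively_computable_on D (\<lambda>\<epsilon>. c)"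
  unfolding effectively_computable_on_def using assms by (intro exI[of _ p]) force

lemma effectively_computable_on_power2: "effectively_computable_on D (\<lambda>\<epsilon> g h. 2 ^ g)"
proof (rule effectively_computable_on_integer_parameters)
  show "computes \<phi> (Comp pow2_prog [Comp add_prog [Proj 0, Proj 2]]) [g, h, n] (2 ^ (g + n))"
    for \<phi> g h n
    by (rule computes_Comp1[OF computes_Comp2[OF computes_Proj computes_Proj computes_add_prog]
          computes_pow2_prog]) auto
qed (rule is_name_power2)

lemma effectively_computable_on_inverse_power4:
  "effectively_computable_on D (\<lambda>\<epsilon> g h. 1 / 4 ^ g)"
proof (rule effectively_computable_on_integer_parameters)
  \<comment> \<open>As \<open>4 ^ g = 2 ^ (2 * g)\<close>, the name of an inverse power of two
    applies, with \<open>2 * g\<close> computed as \<open>g + g\<close>.\<close>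
  show "computes \<phi> (Comp pow2_prog [Comp monus_prog [Comp add_prog [Proj 0, Proj 0], Proj 2]])
      [g, h, n] (2 ^ (n - 2 * g))" for \<phi> g h n
    by (rule computes_Comp1[OF computes_Comp2[OF computes_Comp2[OF computes_Proj computes_Proj
          computes_add_prog] computes_Proj computes_monus_prog]])
      (auto simp: mult_2 intro: computes_pow2_prog)
  show "is_name (\<lambda>n. 2 ^ (n - 2 * g)) (1 / 4 ^ g)" for g
    using is_name_inverse_power2[of "2 * g"] by (simp add: power_mult)
qed

theorem theorem2:
  fixes D :: "(real \<times> nat \<times> nat) set"
  assumes "D = {(\<epsilon>, g, h). \<epsilon> > 0 \<and> 2 \<le> h \<and> h < g \<and> h dvd g \<and> multiplicatively_independent g h}"
  shows "\<exists>c x\<^sub>0. effectively_computable_on D c \<and> effectively_computable_on D x\<^sub>0 \<and>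
    (\<forall>(\<epsilon>, g, h) \<in> D. c \<epsilon> g h > 0 \<and> x\<^sub>0 \<epsilon> g h > 0 \<and>
      (\<forall>x :: real. x \<ge> x\<^sub>0 \<epsilon> g h \<longrightarrow>
        real (card {N :: nat. 0 < N \<and> real N \<le> x \<and> palindrome g N \<and> \<not> palindrome h N})
          \<ge> c \<epsilon> g h * x powr (1 / 2 - \<epsilon>)))"
proof -
  have bound: "1 / 4 ^ g * x powr (1 / 2 - \<epsilon>)
      \<le> real (card {N :: nat. 0 < N \<and> real N \<le> x \<and> palindrome g N \<and> \<not> palindrome h N})"
    if "\<epsilon> > 0" "2 \<le> h" "h < g" "h dvd g" "2 ^ g \<le> x" for \<epsilon> x :: real and g h :: nat
  proof -
    have g: "real g \<le> 2 ^ g"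
      using of_nat_less_two_power[of g, where 'a = real] by simp
    \<comment> \<open>The first bound leaves room for one-digit palindromes; the second makes
      \<open>powr\<close> monotone in the exponent.\<close>
    have x: "real g \<le> x" "1 \<le> x"
      using g that by linarith+
    have "real g ^ 2 \<le> (2 ^ g) ^ 2"
      using g by (intro power_mono) auto
    also have "\<dots> = 4 ^ g"
      by (simp add: power_mult[symmetric] mult.commute[of g] power_mult)
    finally have "1 / 4 ^ g \<le> 1 / real g ^ 2"
      using that by (intro divide_left_mono) auto
    moreover have "x powr (1 / 2 - \<epsilon>) \<le> sqrt x"
      using x that by (simp add: powr_half_sqrt[symmetric] powr_mono)
    ultimately have "1 / 4 ^ g * x powr (1 / 2 - \<epsilon>) \<le> 1 / real g ^ 2 * sqrt x"
      by (intro mult_mono) auto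
    also have "\<dots> \<le> real (card {N. 0 < N \<and> real N \<le> x \<and> palindrome g N \<and> \<not> palindrome h N})"
      using card_palindromes_not_palindromes_ge_sqrt[of h g x] that x by simp
    finally show ?thesis .
  qed
  show ?thesis
    using effectively_computable_on_inverse_power4 effectively_computable_on_power2
    by (intro exI[of _ "\<lambda>\<epsilon> g h. 1 / 4 ^ g"] exI[of _ "\<lambda>\<epsilon> g h. 2 ^ g"])
      (auto simp: assms intro: bound[simplified])
qed

end
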